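(* Let $X$ be a finite point set in a metric space $(M,d)$ and let $0=r_0<r_1<\dots<r_m$. For any $v\in X$, the persistent link complex of $v$ in the Vietoris–Rips filtration equals the persistence complex of Vietoris–Rips complexes of the neighborhoods of $v$: $$\mathrm{Lk}_{\mathcal{VR}}(v)=\mathcal{VR}(N_\bullet(v),r_\bullet),$$ that is, for each index $i$, $\mathrm{Lk}_{\mathcal{VR}(X,r_i)}(v)=\mathcal{VR}(N_i(v),r_i)$ as simplicial complexes, and the transition maps (inclusions) coincide.
   Context: $\mathcal{VR}(Y,r)$ is the simplicial complex whose $k$-simplices are the subsets of $k+1$ points of $Y$ with diameter at most $r$. The Vietoris–Rips filtration of $X$ is $\mathcal{VR}(X,r_0)\hookrightarrow\cdots\hookrightarrow\mathcal{VR}(X,r_m)$. The neighborhood of $v$ at scale $r_i$ is $N_i(v)=\{u\in X\setminus\{v\}\mid d(u,v)\le r_i\}$. The persistent link complex of $v$ has, at index $i$, the complex $\mathrm{Lk}_{\mathcal{VR}(X,r_i)}(v)=\{\sigma\in\mathcal{VR}(X,r_i)\mid v\notin\sigma\text{ and }\sigma\cup\{v\}\in\mathcal{VR}(X,r_i)\}$, with inclusions as transition maps. *)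

theory Defs
  imports "HOL-Analysis.Analysis"
begin

text \<open>A complex is the set of its (finite, nonempty) simplices.  Its vertices need not exhaust the
  ambient point set.\<close>

definition abstract_simplicial_complex :: "'a set set \<Rightarrow> bool" where
  "abstract_simplicial_complex K \<longleftrightarrow>
     (\<forall>\<sigma>\<in>K. finite \<sigma> \<and> \<sigma> \<noteq> {} \<and> (\<forall>\<tau>. \<tau> \<subseteq> \<sigma> \<and> \<tau> \<noteq> {} \<longrightarrow> \<tau> \<in> K))"

definition vertices :: "'a set set \<Rightarrow> 'a set" where
  "vertices K = {x. {x} \<in> K}"

text \<open>Extensionality makes a vertex map determined by its values on the vertices of its domain, so
  that equality of simplicial maps is equality of functions.\<close>

definition is_simplicial_map :: "'a set set \<Rightarrow> 'a set set \<Rightarrow> ('a \<Rightarrow> 'a) \<Rightarrow> bool" where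
  "is_simplicial_map K L f \<longleftrightarrow>
     f \<in> vertices K \<rightarrow>\<^sub>E vertices L \<and> (\<forall>\<sigma>\<in>K. f ` \<sigma> \<in> L)"

text \<open>\<open>transition P i j\<close> is the vertex map of the simplicial map from \<open>stage P i\<close> to \<open>stage P j\<close>,
  for \<open>i \<le> j \<le> m\<close>; the maps between consecutive indices are the case \<open>j = Suc i\<close>.\<close>

record 'a persistence_complex =
  stage :: "nat \<Rightarrow> 'a set set"
  transition :: "nat \<Rightarrow> nat \<Rightarrow> 'a \<Rightarrow> 'a"

definition is_persistence_complex :: "nat \<Rightarrow> 'a persistence_complex \<Rightarrow> bool" where
  "is_persistence_complex m P \<longleftrightarrow>
     (\<forall>i\<le>m. abstract_simplicial_complex (stage P i)) \<and>
     (\<forall>j\<le>m. \<forall>i\<le>j. is_simplicial_map (stage P i) (stage P j) (transition P i j)) \<and>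
     (\<forall>i\<le>m. transition P i i = restrict (\<lambda>x. x) (vertices (stage P i))) \<and>
     (\<forall>k\<le>m. \<forall>j\<le>k. \<forall>i\<le>j. transition P i k =
        compose (vertices (stage P i)) (transition P j k) (transition P i j))"

text \<open>Both components are extensional in the indices, so equality of two such records concerns the
  indices up to \<open>m\<close> only.  That the vertex maps are simplicial, i.e. that \<open>K i \<subseteq> K j\<close> for
  \<open>i \<le> j \<le> m\<close>, is part of \<open>is_persistence_complex\<close>.\<close>

definition inclusion_system :: "nat \<Rightarrow> (nat \<Rightarrow> 'a set set) \<Rightarrow> 'a persistence_complex" where
  "inclusion_system m K =
     \<lparr>stage = (\<lambda>i\<in>{..m}. K i),
      transition = (\<lambda>i\<in>{..m}. \<lambda>j\<in>{i..m}. \<lambda>x\<in>vertices (K i). x)\<rparr>"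

text \<open>The analogue of \<^const>\<open>diameter\<close> for the set-based metric spaces \<^locale>\<open>Metric_space\<close>.\<close>

definition mdiameter :: "('a \<Rightarrow> 'a \<Rightarrow> real) \<Rightarrow> 'a set \<Rightarrow> real" where
  "mdiameter d S = (if S = {} then 0 else SUP (x,y)\<in>S\<times>S. d x y)"

lemma mdiameter_dist: "mdiameter dist S = diameter S"
  by (simp add: mdiameter_def diameter_def)

definition vietoris_rips :: "('a \<Rightarrow> 'a \<Rightarrow> real) \<Rightarrow> 'a set \<Rightarrow> real \<Rightarrow> 'a set set" where
  "vietoris_rips d Y s = {\<sigma>. \<sigma> \<subseteq> Y \<and> finite \<sigma> \<and> \<sigma> \<noteq> {} \<and> mdiameter d \<sigma> \<le> s}"

definition vr_filtration ::
  "('a \<Rightarrow> 'a \<Rightarrow> real) \<Rightarrow> 'a set \<Rightarrow> (nat \<Rightarrow> real) \<Rightarrow> nat \<Rightarrow> 'a persistence_complex" where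
  "vr_filtration d X r m = inclusion_system m (\<lambda>i. vietoris_rips d X (r i))"

definition neighborhood :: "('a \<Rightarrow> 'a \<Rightarrow> real) \<Rightarrow> 'a set \<Rightarrow> real \<Rightarrow> 'a \<Rightarrow> 'a set" where
  "neighborhood d X s v = {u \<in> X - {v}. d u v \<le> s}"

definition link :: "'a set set \<Rightarrow> 'a \<Rightarrow> 'a set set" where
  "link K v = {\<sigma> \<in> K. v \<notin> \<sigma> \<and> \<sigma> \<union> {v} \<in> K}"

definition persistent_link :: "nat \<Rightarrow> 'a persistence_complex \<Rightarrow> 'a \<Rightarrow> 'a persistence_complex" where
  "persistent_link m P v = inclusion_system m (\<lambda>i. link (stage P i) v)"

definition vr_neighborhoods ::
  "('a \<Rightarrow> 'a \<Rightarrow> real) \<Rightarrow> 'a set \<Rightarrow> (nat \<Rightarrow> real) \<Rightarrow> nat \<Rightarrow> 'a \<Rightarrow> 'a persistence_complex" where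
  "vr_neighborhoods d X r m v =
     inclusion_system m (\<lambda>i. vietoris_rips d (neighborhood d X (r i) v) (r i))"

end

theory Submission
  imports Defs
begin

text \<open>A Vietoris-Rips complex is determined by pairwise distances
  (\<open>mem_vietoris_rips\<close>). Hence adjoining \<open>v\<close> to a simplex
  \<open>\<sigma>\<close> that avoids \<open>v\<close> only adds the condition that every point of
  \<open>\<sigma>\<close> is within the scale of \<open>v\<close>, that is, \<open>\<sigma>\<close>
  lies in the neighborhood of \<open>v\<close>. This gives the equality at each scale
  (\<open>link_vietoris_rips\<close>). Transition maps are inclusions, determined by the stages, so
  stagewise equality lifts to the whole system (\<open>inclusion_system_cong\<close>).\<close>

lemma mdiameter_le_iff:
  assumes "finite S" and "S \<noteq> {}"
  shows "mdiameter d S \<le> s \<longleftrightarrow> (\<forall>x\<in>S. \<forall>y\<in>S. d x y \<le> s)"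
proof -
  \<comment> \<open>Finiteness bounds the set of distances, so the real supremum is a genuine least
    upper bound.\<close>
  have "finite ((\<lambda>(x,y). d x y) ` (S \<times> S))"
    using assms by blast
  then have "mdiameter d S \<le> s \<longleftrightarrow> (\<forall>p\<in>S \<times> S. (\<lambda>(x,y). d x y) p \<le> s)"
    using assms unfolding mdiameter_def
    by (simp only: if_False) (intro cSUP_le_iff bdd_above_finite, auto)
  then show ?thesis by simp
qed

lemma mem_vietoris_rips:
  "\<sigma> \<in> vietoris_rips d Y s \<longleftrightarrow>
     \<sigma> \<subseteq> Y \<and> finite \<sigma> \<and> \<sigma> \<noteq> {} \<and> (\<forall>x\<in>\<sigma>. \<forall>y\<in>\<sigma>. d x y \<le> s)"
  unfolding vietoris_rips_def using mdiameter_le_iff[of \<sigma> d s] by auto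

lemma abstract_simplicial_complex_vietoris_rips:
  "abstract_simplicial_complex (vietoris_rips d Y s)"
  unfolding abstract_simplicial_complex_def Ball_def mem_vietoris_rips
  by (intro allI impI conjI; elim conjE) (simp_all, blast intro: finite_subset, blast+)

lemma vietoris_rips_mono:
  "Y \<subseteq> Z \<Longrightarrow> s \<le> t \<Longrightarrow> vietoris_rips d Y s \<subseteq> vietoris_rips d Z t"
  unfolding subset_iff[of "vietoris_rips d Y s"] mem_vietoris_rips
  using order_trans[of _ s t] by blast

lemma neighborhood_mono:
  "s \<le> t \<Longrightarrow> neighborhood d X s v \<subseteq> neighborhood d X t v"
  by (auto simp: neighborhood_def)

lemma (in Metric_space) link_vietoris_rips:
  assumes "X \<subseteq> M" and "v \<in> X"
  shows "link (vietoris_rips d X s) v = vietoris_rips d (neighborhood d X s v) s"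
proof (intro set_eqI iffI)
  fix \<sigma> assume "\<sigma> \<in> link (vietoris_rips d X s) v"
  then show "\<sigma> \<in> vietoris_rips d (neighborhood d X s v) s"
    by (auto simp: link_def mem_vietoris_rips neighborhood_def)
next
  fix \<sigma> assume \<sigma>: "\<sigma> \<in> vietoris_rips d (neighborhood d X s v) s"
  then obtain x where "d x v \<le> s"
    by (auto simp: mem_vietoris_rips neighborhood_def)
  \<comment> \<open>A simplex is nonempty, so some \<open>x\<close> has 0 \<le> \<open>d x v\<close>
    \<le> \<open>s\<close>; this rules out a negative scale.\<close>
  then have "d v v \<le> s"
    using assms order_trans[OF nonneg] by auto
  \<comment> \<open>The pairwise condition ranges over ordered pairs, while
    \<open>neighborhood\<close> bounds only the distance towards \<open>v\<close>.\<close>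
  moreover have "d v y \<le> s" if "d y v \<le> s" for y
    using that commute[of v y] by simp
  ultimately show "\<sigma> \<in> link (vietoris_rips d X s) v"
    using \<sigma> assms(2) by (auto simp: link_def mem_vietoris_rips neighborhood_def)
qed

text \<open>Every simplex is contained in the vertex set of its complex, so the restricted identity
  fixes it, and nesting places it in the later stage.\<close>

lemma is_persistence_complex_inclusion_system:
  assumes "\<And>i. i \<le> m \<Longrightarrow> abstract_simplicial_complex (K i)"
    and K: "\<And>i j. i \<le> j \<Longrightarrow> j \<le> m \<Longrightarrow> K i \<subseteq> K j"
  shows "is_persistence_complex m (inclusion_system m K)"
proof -
  have V: "x \<in> vertices (K j)" if "i \<le> j" "j \<le> m" "x \<in> vertices (K i)" for i j x
    using that K by (auto simp: vertices_def)
  have face_vertices: "\<sigma> \<subseteq> vertices (K i)" if "i \<le> m" "\<sigma> \<in> K i" for i \<sigma>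
  proof
    fix x assume "x \<in> \<sigma>"
    \<comment> \<open>Closure under faces is applied to the singleton face.\<close>
    then have "{x} \<subseteq> \<sigma> \<and> {x} \<noteq> {}" by simp
    then show "x \<in> vertices (K i)"
      using that assms(1) unfolding abstract_simplicial_complex_def vertices_def by blast
  qed
  have "is_simplicial_map (K i) (K j) (\<lambda>x\<in>vertices (K i). x)" if "i \<le> j" "j \<le> m" for i j
  proof -
    have "(\<lambda>x\<in>vertices (K i). x) ` \<sigma> = \<sigma>" if "\<sigma> \<in> K i" for \<sigma>
    proof -
      have "\<sigma> \<subseteq> vertices (K i)"
        using face_vertices that \<open>i \<le> j\<close> \<open>j \<le> m\<close> by simp
      then show ?thesis
        by (simp add: subset_iff cong: image_cong)
    qed
    moreover have "K i \<subseteq> K j" and "vertices (K i) \<subseteq> vertices (K j)"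
      using that V K by blast+
    ultimately show ?thesis
      unfolding is_simplicial_map_def by auto
  qed
  \<comment> \<open>A restricted identity does not mention its target, so the composition law for
    \<open>i\<close> \<le> \<open>j\<close> \<le> \<open>k\<close> involves only \<open>i\<close>
    and \<open>j\<close>.\<close>
  moreover have "(\<lambda>x\<in>vertices (K i). x) =
      compose (vertices (K i)) (\<lambda>x\<in>vertices (K j). x) (\<lambda>x\<in>vertices (K i). x)"
    if "i \<le> j" "j \<le> m" for i j
    using that V by (auto simp: compose_def fun_eq_iff)
  ultimately show ?thesis
    using assms(1) by (auto simp: is_persistence_complex_def inclusion_system_def)
qed

text \<open>Beyond \<open>m\<close> both systems are \<open>undefined\<close>, so agreement up to
  \<open>m\<close> already gives equal records.\<close>

lemma inclusion_system_cong:
  assumes "\<And>i. i \<le> m \<Longrightarrow> K i = L i"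
  shows "inclusion_system m K = inclusion_system m L"
proof -
  have "(\<lambda>i\<in>{..m}. K i) = (\<lambda>i\<in>{..m}. L i)"
    using assms by (intro restrict_ext) simp
  moreover have "(\<lambda>i\<in>{..m}. \<lambda>j\<in>{i..m}. \<lambda>x\<in>vertices (K i). x) =
      (\<lambda>i\<in>{..m}. \<lambda>j\<in>{i..m}. \<lambda>x\<in>vertices (L i). x)"
    using assms by (intro restrict_ext) simp
  ultimately show ?thesis
    unfolding inclusion_system_def by (simp only:)
qed

theorem proposition4p1:
  fixes M :: "'a set" and d :: "'a \<Rightarrow> 'a \<Rightarrow> real" and X :: "'a set"
    and r :: "nat \<Rightarrow> real" and m :: nat and v :: 'a
  assumes "Metric_space M d" and "X \<subseteq> M" and "finite X"
    and "r 0 = 0" and "strict_mono_on {..m} r"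
    and "v \<in> X"
  shows "is_persistence_complex m (persistent_link m (vr_filtration d X r m) v) \<and>
    is_persistence_complex m (vr_neighborhoods d X r m v) \<and>
    persistent_link m (vr_filtration d X r m) v = vr_neighborhoods d X r m v \<and>
    (\<forall>i\<le>m. link (vietoris_rips d X (r i)) v
             = vietoris_rips d (neighborhood d X (r i) v) (r i))"
proof -
  interpret Metric_space M d by fact
  let ?N = "\<lambda>i. vietoris_rips d (neighborhood d X (r i) v) (r i)"
  have link: "link (vietoris_rips d X (r i)) v = ?N i" for i
    using assms by (intro link_vietoris_rips)
  have eq: "persistent_link m (vr_filtration d X r m) v = vr_neighborhoods d X r m v"
    unfolding persistent_link_def vr_neighborhoods_def
    by (intro inclusion_system_cong) (simp add: vr_filtration_def inclusion_system_def link)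
  have "r i \<le> r j" if "i \<le> j" "j \<le> m" for i j
    using strict_mono_on_leD[OF assms(5)] that by simp
  \<comment> \<open>Nesting holds because both the neighborhood and the scale grow with the index.
    The link system inherits the property through \<open>eq\<close>.\<close>
  then have "is_persistence_complex m (vr_neighborhoods d X r m v)"
    unfolding vr_neighborhoods_def
    by (intro is_persistence_complex_inclusion_system abstract_simplicial_complex_vietoris_rips
        vietoris_rips_mono neighborhood_mono)
  with eq link show ?thesis by simp
qed

end
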